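(* Let $1/4<\lambda<1/2$. Let $K_\lambda\subset[0,1]$ be the unique nonempty compact set with $K_\lambda=\lambda K_\lambda\cup(\lambda K_\lambda+1-\lambda)$, let $C_\lambda=K_\lambda\times K_\lambda$, and let $S^1=\{(x,y)\in\mathbb{R}^2:x^2+y^2=1\}$. Then the Minkowski sum $A_\lambda=C_\lambda+S^1$ has nonempty interior in $\mathbb{R}^2$.
   Context: For $F,\Gamma\subset\mathbb{R}^2$, the Minkowski sum is $F+\Gamma=\{x+y:x\in F,\ y\in\Gamma\}$. *)

theory Defs
  imports "HOL-Analysis.Analysis"
begin

definition ifs :: "real \<Rightarrow> real set \<Rightarrow> real set" where
  "ifs l A = (\<lambda>x. l * x) ` A \<union> (\<lambda>x. l * x + 1 - l) ` A"

text \<open>Lemma \<open>ex1_cantor_set\<close> below establishes existence and uniqueness for \<open>0 < l < 1\<close>, and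
  \<open>cantor_set_unique\<close> shows that uniqueness holds among all compact subsets of the line.\<close>

definition cantor_set :: "real \<Rightarrow> real set" where
  "cantor_set l = (THE K. K \<subseteq> {0..1} \<and> compact K \<and> K \<noteq> {} \<and> K = ifs l K)"

definition cantor_square :: "real \<Rightarrow> (real \<times> real) set" where
  "cantor_square l = cantor_set l \<times> cantor_set l"

definition unit_circle :: "(real \<times> real) set" where
  "unit_circle = {(x, y). x\<^sup>2 + y\<^sup>2 = 1}"

lemma ifs_mono: "A \<subseteq> B \<Longrightarrow> ifs l A \<subseteq> ifs l B"
  unfolding ifs_def by blast

lemma compact_ifs: "compact A \<Longrightarrow> compact (ifs l A)"
  unfolding ifs_def
  by (intro compact_Un compact_continuous_image continuous_intros)

lemma infdist_affine_le:
  assumes "0 \<le> l" "(\<lambda>x. l * x + c) ` B \<subseteq> B" "compact B" "B \<noteq> {}"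
  shows "infdist (l * y + c) B \<le> l * infdist y (B :: real set)"
proof -
  obtain b where b: "b \<in> B" "infdist y B = dist y b"
    using infdist_attains_inf[of B y] assms compact_imp_closed by blast
  have "infdist (l * y + c) B \<le> dist (l * y + c) (l * b + c)"
    using assms(2) b(1) by (intro infdist_le) auto
  also have "\<dots> = l * dist y b"
    using assms(1) by (simp add: dist_real_def flip: right_diff_distrib)
      (simp add: abs_mult)
  finally show ?thesis using b by simp
qed

lemma ifs_fixpoint_subset:
  assumes l: "0 < l" "l < 1"
    and A: "compact A" "A \<noteq> {}" "A = ifs l A"
    and B: "compact B" "B \<noteq> {}" "B = ifs l B"
  shows "A \<subseteq> B"
proof -
  obtain x where x: "x \<in> A" "\<And>y. y \<in> A \<Longrightarrow> infdist y B \<le> infdist x B"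
    using continuous_attains_sup[OF A(1,2), of "\<lambda>y. infdist y B"]
      continuous_on_infdist[OF continuous_on_id, of A B] by auto
  have fB: "(\<lambda>x. l * x + 0) ` B \<subseteq> B" "(\<lambda>x. l * x + (1 - l)) ` B \<subseteq> B"
    using B(3) unfolding ifs_def by (auto simp: algebra_simps)
  obtain y where y: "y \<in> A" "x = l * y + 0 \<or> x = l * y + (1 - l)"
  proof -
    have "x \<in> ifs l A" using x(1) A(3) by blast
    then show thesis using that unfolding ifs_def by (auto simp: algebra_simps)
  qed
  have "infdist x B \<le> l * infdist y B"
    using y(2) infdist_affine_le[OF _ fB(1) B(1,2), of y]
      infdist_affine_le[OF _ fB(2) B(1,2), of y] l by auto
  also have "\<dots> \<le> l * infdist x B"
    using x(2)[OF y(1)] l by simp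
  finally have "(1 - l) * infdist x B \<le> 0" by (simp add: algebra_simps)
  then have "infdist x B \<le> 0" using l by (simp add: mult_le_0_iff)
  then have "infdist y B = 0" if "y \<in> A" for y
    using x(2)[OF that] infdist_nonneg[of y B] by linarith
  then show ?thesis
    using in_closed_iff_infdist_zero[OF compact_imp_closed[OF B(1)] B(2)] by auto
qed

lemma ex_ifs_fixpoint:
  assumes l: "0 < l" "l < 1"
  shows "\<exists>K. K \<subseteq> {0..1} \<and> compact K \<and> K \<noteq> {} \<and> K = ifs l K"
proof -
  define K where "K = \<Union>{A. A \<subseteq> {0..1} \<and> A \<subseteq> ifs l A}"
  have K01: "K \<subseteq> {0..1}" unfolding K_def by blast
  have max: "A \<subseteq> K" if "A \<subseteq> {0..1}" "A \<subseteq> ifs l A" for A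
    unfolding K_def using that by blast
  have sub: "K \<subseteq> ifs l K"
    unfolding K_def using ifs_mono[of _ "\<Union>{A. A \<subseteq> {0..1} \<and> A \<subseteq> ifs l A}" l] by blast
  have unit: "ifs l A \<subseteq> {0..1}" if "A \<subseteq> {0..1}" for A
  proof -
    have "0 \<le> l * x \<and> l * x \<le> l" if "x \<in> A" for x
      using that \<open>A \<subseteq> {0..1}\<close> l by (auto simp: mult_left_le)
    then have "0 \<le> l * x \<and> l * x \<le> 1 \<and> 0 \<le> l * x + 1 - l \<and> l * x + 1 - l \<le> 1" if "x \<in> A" for x
      using l that by (smt (verit))
    then show ?thesis unfolding ifs_def by auto
  qed
  have eq: "K = ifs l K"
    using sub max[OF unit[OF K01] ifs_mono[OF sub]] by blast
  have ne: "K \<noteq> {}"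
    using max[of "{0}"] by (auto simp: ifs_def)
  have cl01: "closure K \<subseteq> {0..1}"
    using K01 by (intro closure_minimal) auto
  then have "compact (closure K)"
    using bounded_subset[OF bounded_closed_interval] by (auto simp: compact_eq_bounded_closed)
  then have "closure K \<subseteq> ifs l (closure K)"
    using sub ifs_mono[OF closure_subset, of l K]
    by (intro closure_minimal compact_imp_closed compact_ifs) auto
  then have "closure K = K"
    using max[OF cl01] closure_subset by blast
  then have "compact K" using \<open>compact (closure K)\<close> by simp
  with K01 ne eq show ?thesis by blast
qed

lemma ex1_cantor_set:
  assumes "0 < l" "l < 1"
  shows "\<exists>!K. K \<subseteq> {0..1} \<and> compact K \<and> K \<noteq> {} \<and> K = ifs l K"
  using ex_ifs_fixpoint[OF assms] ifs_fixpoint_subset[OF assms]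
  by (metis (no_types, lifting) subset_antisym)

lemma cantor_set_properties:
  assumes "0 < l" "l < 1"
  shows "cantor_set l \<subseteq> {0..1}" "compact (cantor_set l)" "cantor_set l \<noteq> {}"
    "cantor_set l = ifs l (cantor_set l)"
  using theI'[OF ex1_cantor_set[OF assms]] unfolding cantor_set_def by blast+

lemma cantor_set_unique:
  assumes "0 < l" "l < 1" "compact K" "K \<noteq> {}" "K = ifs l K"
  shows "K = cantor_set l"
  using ifs_fixpoint_subset[OF assms(1,2)] cantor_set_properties[OF assms(1,2)] assms(3-5)
  by (metis subset_antisym)

end

theory Submission
  imports Defs
begin

text \<open>Write \<open>K\<close> for the Cantor set and \<open>m = sqrt l\<close>. A point \<open>p\<close> lies in the Minkowski sum iff the
  unit circle about \<open>p\<close> meets \<open>K \<times> K\<close>. The circle has tangents in every direction, so one may use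
  the direction best suited to \<open>K \<times> K\<close>, that of the lines \<open>x + m * y = const\<close>. It is distinguished
  because \<open>K = {(1 - l) * (\<Sum>n. d n * l ^ n) | d n \<in> {0, 1}}\<close>, so that \<open>K + m * K\<close> is, up to the
  factor \<open>1 - l\<close>, the set of all expansions \<open>\<Sum>n. d n * m ^ n\<close> with digits 0 and 1. The condition
  \<open>l > 1/4\<close> says exactly that \<open>m > 1/2\<close>: then these expansions fill an interval of length
  \<open>1 / (1 - m)\<close>, and the four first-level pieces of that interval overlap (lemma
  \<open>two_scale_digit_cover\<close>).

  The overlap leaves room for curvature. Among the subsquares of \<open>K \<times> K\<close> follow those that a level
  curve \<open>f = c\<close> crosses well away from the extreme corners. If the increments of \<open>f\<close> are close to
  those of \<open>A * (x + m * y)\<close> relative to the size of the increments, then by the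
  overlap one of the four children of a well-crossed square is again well crossed; the relative error
  does not grow under rescaling. Hence squares of every size in \<open>K \<times> K\<close> are well crossed, and
  by compactness \<open>f = c\<close> meets \<open>K \<times> K\<close> (lemma \<open>level_set_meets_product\<close>).

  For \<open>f (x, y) = (x - p1)\<^sup>2 + (y - p2)\<^sup>2\<close> and \<open>c = 1\<close>, all hypotheses hold on a small square at
  the corner \<open>(0, 0)\<close> of \<open>K \<times> K\<close> as soon as the gradient of \<open>f\<close> there is nearly parallel to
  \<open>(1, m)\<close> and \<open>1 - f (0, 0)\<close> lies in a certain interval. These are open conditions on \<open>p\<close>, and they
  are met by a point \<open>p\<close> close to the unit vector \<open>- (1, m) / sqrt (1 + l)\<close>.\<close>

text \<open>The four intervals \<open>d + e * m + {0..m\<^sup>2 * L}\<close> with \<open>L = 1 / (1 - m)\<close> cover \<open>{0..L}\<close>.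
  Consecutive ones overlap in length at least \<open>m * (2 * m - 1) / (1 - m) \<ge> 2 * m - 1\<close>, so the
  covering survives shrinking each of them, and \<open>{0..L}\<close>, by \<open>\<delta>\<close> at both ends.\<close>

lemma two_scale_digit_cover:
  fixes m L \<delta> v :: real
  assumes m: "1/2 < m" "m < 1" and L: "(1 - m) * L = 1"
    and \<delta>: "2 * \<delta> \<le> 2 * m - 1" and v: "\<delta> \<le> v" "v \<le> L - \<delta>"
  obtains d e :: real where "d \<in> {0, 1}" "e \<in> {0, 1}"
    "\<delta> \<le> v - (d + m * e)" "v - (d + m * e) \<le> m\<^sup>2 * L - \<delta>"
proof -
  have mL1: "m * L = L - 1"
    using L by (simp add: algebra_simps)
  have "0 < (L - 2) * (1 - m)"
    using m mL1 by (simp add: algebra_simps)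
  then have L2: "2 < L"
    using m by (simp add: zero_less_mult_iff)
  have "0 \<le> (2 * m - 1) * (L - 2)"
    using m L2 by simp
  then have gap1: "2 * (2 * m - 1) \<le> m * L - 1"
    using mL1 by (simp add: algebra_simps)
  then have "m * (2 * (2 * m - 1)) \<le> m * (m * L - 1)"
    using m by (intro mult_left_mono) auto
  moreover have "1 * (2 * m - 1) \<le> (2 * m) * (2 * m - 1)"
    using m by (intro mult_right_mono) auto
  ultimately have gap2: "2 * m - 1 \<le> m\<^sup>2 * L - m"
    by (simp add: algebra_simps power2_eq_square)
  have mL: "m * L = m + m\<^sup>2 * L"
    using arg_cong[OF L, of "\<lambda>x. m * x"] by (simp add: algebra_simps power2_eq_square)
  have "m + \<delta> \<le> v" if "\<not> v \<le> m\<^sup>2 * L - \<delta>"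
    using that gap2 \<delta> by linarith
  moreover have "1 + \<delta> \<le> v" if "\<not> v \<le> m * L - \<delta>"
    using that gap1 \<delta> m by argo
  moreover have "1 + m + \<delta> \<le> v" if "\<not> v \<le> 1 + m\<^sup>2 * L - \<delta>"
    using that gap2 \<delta> by linarith
  ultimately consider "v \<le> m\<^sup>2 * L - \<delta>" | "m + \<delta> \<le> v" "v \<le> m * L - \<delta>"
    | "1 + \<delta> \<le> v" "v \<le> 1 + m\<^sup>2 * L - \<delta>" | "1 + m + \<delta> \<le> v"
    by blast
  then show thesis
  proof cases
    case 1 then show ?thesis using that[of 0 0] v by simp
  next
    case 2 then show ?thesis using that[of 0 1] mL by simp
  next
    case 3 then show ?thesis using that[of 1 0] by simp
  next
    case 4 then show ?thesis using that[of 1 1] mL mL1 v by simp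
  qed
qed

text \<open>The square with lower left corner \<open>(a, b)\<close> and side \<open>r\<close> is well crossed when \<open>c - f (a, b)\<close>,
  measured in units of \<open>A * (1 - l) * r\<close>, lies in \<open>{\<delta>..L - \<delta>}\<close>. Passing to a child subtracts a
  two-scale digit, with an error of at most \<open>(1 - l) * \<delta>\<close>, and divides by \<open>l\<close>. The digit can be chosen
  so that \<open>{\<delta>..l * L - \<delta>}\<close> is hit before the error; after it, the value lies in
  \<open>{l * \<delta>..l * (L - \<delta>)}\<close>, which rescales to the original interval.\<close>

lemma level_set_meets_product:
  fixes K :: "real set" and f :: "real \<times> real \<Rightarrow> real" and m A \<rho> c :: real
  defines "l \<equiv> m\<^sup>2" and "\<delta> \<equiv> (2 * m - 1) / 2"
  assumes K: "compact K" "0 \<in> K"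
    "\<And>x. x \<in> K \<Longrightarrow> l * x \<in> K" "\<And>x. x \<in> K \<Longrightarrow> l * x + 1 - l \<in> K"
    and \<rho>: "0 < \<rho>" "\<And>x. x \<in> K \<Longrightarrow> \<rho> * x \<in> K"
    and m: "1/2 < m" "m < 1" and L: "(1 - m) * L = 1" and A: "0 < A"
    and cont: "continuous_on (K \<times> K) f"
    and incr: "\<And>x y s t. \<lbrakk>0 \<le> x; 0 \<le> s; x + s \<le> \<rho>; 0 \<le> y; 0 \<le> t; y + t \<le> \<rho>\<rbrakk> \<Longrightarrow>
      \<bar>f (x + s, y + t) - f (x, y) - A * (s + m * t)\<bar> \<le> A * ((1 - l) * \<delta>) / 2 * (s + t)"
    and c: "A * (1 - l) * \<rho> * \<delta> \<le> c - f (0, 0)" "c - f (0, 0) \<le> A * (1 - l) * \<rho> * (L - \<delta>)"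
  shows "\<exists>z \<in> K \<times> K. f z = c"
proof -
  have l: "0 < l" "l < 1"
    using m power_strict_mono[of m 1 2] by (auto simp: l_def)
  have \<delta>: "0 < \<delta>" "2 * \<delta> \<le> 2 * m - 1"
    using m by (auto simp: \<delta>_def)
  define crossed where "crossed r a b \<longleftrightarrow>
      0 \<le> a \<and> a + r \<le> \<rho> \<and> (\<forall>x\<in>K. a + r * x \<in> K) \<and>
      0 \<le> b \<and> b + r \<le> \<rho> \<and> (\<forall>x\<in>K. b + r * x \<in> K) \<and>
      A * (1 - l) * r * \<delta> \<le> c - f (a, b) \<and> c - f (a, b) \<le> A * (1 - l) * r * (L - \<delta>)"
    for r a b
  have child: "\<exists>a' b'. crossed (l * r) a' b'" if X: "crossed r a b" and r: "0 < r" for r a b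
  proof -
    define B where "B = A * (1 - l) * r"
    define v where "v = (c - f (a, b)) / B"
    have B: "0 < B" using A l r by (simp add: B_def)
    have "\<delta> \<le> v" "v \<le> L - \<delta>"
      using X B unfolding crossed_def v_def B_def[symmetric] by (auto simp: field_simps)
    then obtain d e where d: "d \<in> {0, 1}" and e: "e \<in> {0, 1}" and
      de: "\<delta> \<le> v - (d + m * e)" "v - (d + m * e) \<le> l * L - \<delta>"
      using two_scale_digit_cover[OF m L \<delta>(2)] unfolding l_def by metis
    define s where "s = d * ((1 - l) * r)"
    define t where "t = e * ((1 - l) * r)"
    have size: "0 \<le> u * ((1 - l) * r)" "u * ((1 - l) * r) + l * r \<le> r"
      "u * ((1 - l) * r) \<le> (1 - l) * r" if "u \<in> {0, 1}" for u
      using that l r by (auto simp: algebra_simps)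
    have st: "0 \<le> s" "s + l * r \<le> r" "s \<le> (1 - l) * r" "0 \<le> t" "t + l * r \<le> r" "t \<le> (1 - l) * r"
      using size[OF d] size[OF e] by (auto simp: s_def t_def)
    have lr: "0 < l * r" using l r by simp
    have "\<bar>f (a + s, b + t) - f (a, b) - A * (s + m * t)\<bar> \<le> A * ((1 - l) * \<delta>) / 2 * (s + t)"
      using X st lr by (intro incr) (auto simp: crossed_def)
    also have "\<dots> \<le> A * ((1 - l) * \<delta>) / 2 * (2 * ((1 - l) * r))"
      using st A l \<delta> by (intro mult_left_mono) auto
    also have "\<dots> = B * ((1 - l) * \<delta>)"
      by (simp add: B_def)
    finally have err: "\<bar>f (a + s, b + t) - f (a, b) - A * (s + m * t)\<bar> \<le> B * ((1 - l) * \<delta>)" .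
    have lin: "A * (s + m * t) = B * (d + m * e)"
      by (simp add: B_def s_def t_def algebra_simps)
    have "c - f (a, b) = B * v"
      using B by (simp add: v_def)
    moreover have "B * \<delta> \<le> B * (v - (d + m * e))" "B * (v - (d + m * e)) \<le> B * (l * L - \<delta>)"
      using de B by (auto intro: mult_left_mono)
    ultimately have
      "B * \<delta> - B * ((1 - l) * \<delta>) \<le> c - f (a + s, b + t)"
      "c - f (a + s, b + t) \<le> B * (l * L - \<delta>) + B * ((1 - l) * \<delta>)"
      using err lin unfolding right_diff_distrib[of B v] by linarith+
    then have cross:
      "A * (1 - l) * (l * r) * \<delta> \<le> c - f (a + s, b + t)"
      "c - f (a + s, b + t) \<le> A * (1 - l) * (l * r) * (L - \<delta>)"
      by (simp_all add: B_def algebra_simps)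
    have inK: "a0 + u * ((1 - l) * r) + l * r * x \<in> K"
      if "\<forall>x\<in>K. a0 + r * x \<in> K" "u \<in> {0, 1}" "x \<in> K" for a0 u x
    proof -
      have "l * x \<in> K" "l * x + 1 - l \<in> K"
        using K that(3) by auto
      then have "a0 + r * (l * x) \<in> K" "a0 + r * (l * x + 1 - l) \<in> K"
        using that(1) by auto
      then show ?thesis using that(2) by (auto simp: algebra_simps)
    qed
    have "crossed (l * r) (a + s) (b + t)"
      using X st cross inK[OF _ d] inK[OF _ e] unfolding crossed_def s_def t_def by auto
    then show ?thesis by blast
  qed
  have all_scales: "\<exists>a b. crossed (l ^ n * \<rho>) a b" for n
  proof (induction n)
    case 0
    have "crossed \<rho> 0 0"
      using c \<rho> by (auto simp: crossed_def)
    then show ?case by auto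
  next
    case (Suc n)
    then show ?case
      using child[of "l ^ n * \<rho>"] l \<rho> by (auto simp: mult.assoc)
  qed
  \<comment> \<open>The corners of well-crossed squares belong to \<open>K \<times> K\<close>, and there \<open>f\<close> approaches \<open>c\<close>.\<close>
  have "\<forall>n. \<exists>z \<in> K \<times> K. 0 \<le> c - f z \<and> c - f z \<le> A * (1 - l) * (l ^ n * \<rho>) * (L - \<delta>)"
  proof
    fix n
    obtain a b where ab: "crossed (l ^ n * \<rho>) a b" using all_scales by blast
    have "a \<in> K" "b \<in> K"
      using ab K(2) unfolding crossed_def by fastforce+
    moreover have "0 \<le> A * (1 - l) * (l ^ n * \<rho>) * \<delta>"
      using A l \<delta> \<rho> by simp
    ultimately show "\<exists>z \<in> K \<times> K. 0 \<le> c - f z \<and> c - f z \<le> A * (1 - l) * (l ^ n * \<rho>) * (L - \<delta>)"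
      using ab unfolding crossed_def by (intro bexI[of _ "(a, b)"]) auto
  qed
  then obtain z where z: "\<And>n. z n \<in> K \<times> K" "\<And>n. 0 \<le> c - f (z n)"
      "\<And>n. c - f (z n) \<le> A * (1 - l) * (l ^ n * \<rho>) * (L - \<delta>)"
    by metis
  have "(\<lambda>n. A * (1 - l) * (l ^ n * \<rho>) * (L - \<delta>)) \<longlonglongrightarrow> A * (1 - l) * (0 * \<rho>) * (L - \<delta>)"
    using l by (intro tendsto_intros LIMSEQ_realpow_zero) auto
  then have "(\<lambda>n. A * (1 - l) * (l ^ n * \<rho>) * (L - \<delta>)) \<longlonglongrightarrow> 0"
    by simp
  then have "(\<lambda>n. c - f (z n)) \<longlonglongrightarrow> 0"
    by (rule tendsto_sandwich[OF _ _ tendsto_const, rotated 2]) (use z in auto)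
  then have "(\<lambda>n. f (z n)) \<longlonglongrightarrow> c"
    using tendsto_diff[OF tendsto_const[of c]] by fastforce
  moreover have "closed (f ` (K \<times> K))"
    using K cont by (intro compact_imp_closed compact_continuous_image compact_Times)
  ultimately have "c \<in> f ` (K \<times> K)"
    using z(1) closed_sequentially[of "f ` (K \<times> K)" "\<lambda>n. f (z n)" c] by blast
  then show ?thesis by auto
qed

lemma cantor_set_maps:
  assumes "0 < l" "l < 1" "x \<in> cantor_set l"
  shows "l * x \<in> cantor_set l" "l * x + 1 - l \<in> cantor_set l"
  using cantor_set_properties(4)[OF assms(1,2)] assms(3) unfolding ifs_def by blast+

lemma zero_in_cantor_set:
  assumes l: "0 < l" "l < 1"
  shows "0 \<in> cantor_set l"
proof -
  obtain a where a: "a \<in> cantor_set l" "\<And>x. x \<in> cantor_set l \<Longrightarrow> a \<le> x"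
    using compact_attains_inf[OF cantor_set_properties(2,3)[OF l]] by blast
  have "a \<le> l * a"
    using a cantor_set_maps(1)[OF l] by blast
  then have "(1 - l) * a \<le> 0"
    by (simp add: algebra_simps)
  then have "a \<le> 0"
    using l by (simp add: mult_le_0_iff)
  moreover have "0 \<le> a"
    using a cantor_set_properties(1)[OF l] by auto
  ultimately show ?thesis using a by simp
qed

lemma power_times_cantor_set:
  assumes "0 < l" "l < 1" "x \<in> cantor_set l"
  shows "l ^ n * x \<in> cantor_set l"
  by (induction n) (use assms cantor_set_maps(1) in \<open>auto simp: mult.assoc\<close>)

lemma mem_plus_unit_circle_iff:
  "(p, q) \<in> S + unit_circle \<longleftrightarrow> (\<exists>(x, y) \<in> S. (x - p)\<^sup>2 + (y - q)\<^sup>2 = 1)"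
proof
  assume "(p, q) \<in> S + unit_circle"
  then obtain x y u v where "(x, y) \<in> S" "u\<^sup>2 + v\<^sup>2 = 1" "p = x + u" "q = y + v"
    by (auto simp: unit_circle_def elim!: set_plus_elim)
  then show "\<exists>(x, y) \<in> S. (x - p)\<^sup>2 + (y - q)\<^sup>2 = 1"
    by (intro bexI[of _ "(x, y)"]) auto
next
  assume "\<exists>(x, y) \<in> S. (x - p)\<^sup>2 + (y - q)\<^sup>2 = 1"
  then obtain x y where xy: "(x, y) \<in> S" "(x - p)\<^sup>2 + (y - q)\<^sup>2 = 1" by auto
  then have "(p - x, q - y) \<in> unit_circle"
    by (simp add: unit_circle_def power2_commute)
  then have "(x, y) + (p - x, q - y) \<in> S + unit_circle"
    using xy by (intro set_plus_intro)
  then show "(p, q) \<in> S + unit_circle" by simp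
qed

text \<open>The increment of \<open>(x - p)\<^sup>2\<close> over \<open>s\<close> is \<open>s * (2 * x + s - 2 * p)\<close>, with slope between
  \<open>- 2 * p\<close> and \<open>2 * \<rho> - 2 * p\<close>.\<close>

lemma square_increment_bound:
  fixes x s p \<rho> \<alpha> \<kappa> :: real
  assumes "0 \<le> x" "0 \<le> s" "x + s \<le> \<rho>" "2 * \<rho> + \<bar>- 2 * p - \<alpha>\<bar> \<le> \<kappa>"
  shows "\<bar>(x + s - p)\<^sup>2 - (x - p)\<^sup>2 - \<alpha> * s\<bar> \<le> \<kappa> * s"
proof -
  have "(x + s - p)\<^sup>2 - (x - p)\<^sup>2 - \<alpha> * s = (2 * x + s - 2 * p - \<alpha>) * s"
    by (simp add: power2_eq_square algebra_simps)
  moreover have "\<bar>2 * x + s - 2 * p - \<alpha>\<bar> \<le> \<kappa>"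
    using assms by linarith
  ultimately show ?thesis
    using assms(2) by (simp add: abs_mult mult_right_mono)
qed

theorem theorem1p2:
  fixes l :: real
  assumes "1/4 < l" and "l < 1/2"
  shows "interior (cantor_square l + unit_circle) \<noteq> {}"
proof -
  define K where "K = cantor_set l"
  define m where "m = sqrt l"
  have l: "0 < l" "l < 1" using assms by auto
  have m2: "m\<^sup>2 = l" using l by (simp add: m_def)
  have m: "1/2 < m" "m < 1"
    using real_less_rsqrt[of "1/2" l] assms by (auto simp: m_def power2_eq_square)
  define \<delta> where "\<delta> = (2 * m - 1) / 2"
  define L where "L = 1 / (1 - m)"
  have L: "(1 - m) * L = 1" using m by (simp add: L_def field_simps)
  have L2: "2 < L" using m by (simp add: L_def field_simps)
  have \<delta>: "0 < \<delta>" "\<delta> < 1/2" using m by (auto simp: \<delta>_def)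
  \<comment> \<open>\<open>A * (1, m) / 2\<close> is the unit vector in the direction \<open>(1, m)\<close>.\<close>
  define A where "A = 2 / sqrt (1 + l)"
  have A: "0 < A" "A \<le> 2"
    using l by (auto simp: A_def field_simps)
  have A2: "A\<^sup>2 * (1 + m\<^sup>2) = 4"
    using l by (simp add: A_def m2 power_divide field_simps)
  define \<kappa> where "\<kappa> = A * ((1 - l) * \<delta>) / 2"
  have \<kappa>: "0 < \<kappa>" using A l \<delta> by (simp add: \<kappa>_def)
  have \<kappa>1: "\<kappa> < 1"
  proof -
    have "A * ((1 - l) * \<delta>) \<le> 2 * (1 * \<delta>)"
      using A l \<delta> by (intro mult_mono) auto
    then show ?thesis using \<delta> unfolding \<kappa>_def by linarith
  qed
  \<comment> \<open>Half of the tolerance \<open>\<kappa>\<close> absorbs the variation \<open>2 * \<rho>\<close> of the partial derivatives over the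
    square. The other half is for the gradient at the corner, which at the centre chosen below is off
    by at most \<open>2 * \<sigma> \<le> 4 * \<rho>\<close>; this is where \<open>\<kappa> / 8\<close> comes from.\<close>
  obtain N where N: "l ^ N < \<kappa> / 8"
    using real_arch_pow_inv[of "\<kappa> / 8" l] \<kappa> l by auto
  define \<rho> where "\<rho> = l ^ N"
  have \<rho>: "0 < \<rho>" "\<rho> < \<kappa> / 8" using l N by (auto simp: \<rho>_def)
  define \<sigma> where "\<sigma> = A * (1 - l) * \<rho>"
  have \<sigma>: "0 < \<sigma>" using A l \<rho> by (simp add: \<sigma>_def)
  have "A * (1 - l) \<le> 2 * 1"
    using A l by (intro mult_mono) auto
  then have \<sigma>': "\<sigma> \<le> 2 * \<rho>"
    using \<rho> unfolding \<sigma>_def by (intro mult_right_mono) auto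

  define U :: "(real \<times> real) set" where
    "U = {z. \<bar>- 2 * fst z - A\<bar> < \<kappa> / 2} \<inter> {z. \<bar>- 2 * snd z - A * m\<bar> < \<kappa> / 2} \<inter>
      {z. \<sigma> * \<delta> < 1 - ((fst z)\<^sup>2 + (snd z)\<^sup>2)} \<inter> {z. 1 - ((fst z)\<^sup>2 + (snd z)\<^sup>2) < \<sigma> * (L - \<delta>)}"
  have "open U"
    unfolding U_def by (intro open_Int open_Collect_less continuous_intros)

  have "U \<subseteq> cantor_square l + unit_circle"
  proof
    fix z assume "z \<in> U"
    obtain p q where z: "z = (p, q)" by force
    define f where "f = (\<lambda>w :: real \<times> real. (fst w - p)\<^sup>2 + (snd w - q)\<^sup>2)"
    have pq: "2 * \<rho> + \<bar>- 2 * p - A\<bar> \<le> \<kappa>" "2 * \<rho> + \<bar>- 2 * q - A * m\<bar> \<le> \<kappa>"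
      using \<open>z \<in> U\<close> \<rho> by (auto simp: U_def z)
    have c: "A * (1 - l) * \<rho> * \<delta> \<le> 1 - f (0, 0)" "1 - f (0, 0) \<le> A * (1 - l) * \<rho> * (L - \<delta>)"
      using \<open>z \<in> U\<close> by (auto simp: U_def z f_def simp flip: \<sigma>_def)
    have incr: "\<bar>f (x + s, y + t) - f (x, y) - A * (s + m * t)\<bar> \<le> A * ((1 - l) * \<delta>) / 2 * (s + t)"
      if "0 \<le> x" "0 \<le> s" "x + s \<le> \<rho>" "0 \<le> y" "0 \<le> t" "y + t \<le> \<rho>" for x y s t
      using square_increment_bound[OF that(1-3) pq(1)] square_increment_bound[OF that(4-6) pq(2)]
      unfolding f_def \<kappa>_def[symmetric] by (simp add: distrib_left mult.assoc)
    have "\<exists>w \<in> K \<times> K. f w = 1"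
    proof (rule level_set_meets_product[where m = m and A = A and \<rho> = \<rho> and L = L,
          unfolded m2, folded \<delta>_def])
      show "compact K" "0 \<in> K"
        using cantor_set_properties(2)[OF l] zero_in_cantor_set[OF l] by (auto simp: K_def)
      show "l * x \<in> K" "l * x + 1 - l \<in> K" "\<rho> * x \<in> K" if "x \<in> K" for x
        using that cantor_set_maps[OF l] power_times_cantor_set[OF l] by (auto simp: K_def \<rho>_def)
      show "continuous_on (K \<times> K) f"
        unfolding f_def by (intro continuous_intros)
    qed (use \<rho> m L A c incr in auto)
    then show "z \<in> cantor_square l + unit_circle"
      unfolding z mem_plus_unit_circle_iff cantor_square_def K_def f_def
      by (auto simp: case_prod_unfold)
  qed

  \<comment> \<open>Pulling the unit vector back by the factor \<open>h\<close> gives it squared norm \<open>1 - \<sigma>\<close>, and \<open>\<sigma>\<close> is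
    inside the admissible interval because \<open>\<delta> < 1 < L - \<delta>\<close>.\<close>
  moreover have "U \<noteq> {}"
  proof -
    define h where "h = sqrt (1 - \<sigma>)"
    have \<sigma>1: "\<sigma> < 1" using \<sigma>' \<rho> \<kappa>1 by linarith
    have h2: "h\<^sup>2 = 1 - \<sigma>" using \<sigma>1 by (simp add: h_def)
    have "0 \<le> h" "h \<le> 1" using \<sigma> \<sigma>1 by (auto simp: h_def)
    then have h: "0 \<le> 1 - h" "1 - h \<le> \<sigma>"
      using h2 mult_left_mono[of h 1 h] by (auto simp: power2_eq_square)
    have "A * (1 - h) \<le> 2 * \<sigma>"
      using A h \<sigma> by (intro mult_mono) auto
    then have small: "A * (1 - h) < \<kappa> / 2"
      using \<sigma>' \<rho> by linarith
    have "A * (1 - h) * m \<le> A * (1 - h)"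
      using A h m by (intro mult_left_le) auto
    then have small': "A * (1 - h) * m < \<kappa> / 2"
      using small by linarith
    have nonneg: "0 \<le> A * (1 - h)" "0 \<le> A * (1 - h) * m"
      using A h m by auto
    have e1: "- 2 * (- (h * A / 2)) - A = - (A * (1 - h))"
      "- 2 * (- (h * A * m / 2)) - A * m = - (A * (1 - h) * m)"
      by (simp_all add: algebra_simps)
    have "(- (h * A / 2))\<^sup>2 + (- (h * A * m / 2))\<^sup>2 = h\<^sup>2 * (A\<^sup>2 * (1 + m\<^sup>2)) / 4"
      by (simp add: power2_eq_square algebra_simps)
    then have norm: "1 - ((- (h * A / 2))\<^sup>2 + (- (h * A * m / 2))\<^sup>2) = \<sigma>"
      unfolding A2 h2 by simp
    have "\<sigma> * \<delta> < \<sigma>" "\<sigma> < \<sigma> * (L - \<delta>)"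
      using \<sigma> \<delta> L2 by auto
    then have "(- (h * A / 2), - (h * A * m / 2)) \<in> U"
      unfolding U_def using small small' nonneg
      by (simp only: Int_iff mem_Collect_eq fst_conv snd_conv e1 norm) auto
    then show ?thesis by blast
  qed
  ultimately show ?thesis
    using interior_maximal[OF _ \<open>open U\<close>] by blast
qed

end
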